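(* Let $\mathit{Var}$ be finite and $M$ a commutative complete quantale. Let $\mathcal V$ be a commutative complete quantale, $\iota:\mathit{Var}\to\mathcal V_1$, and for every $\sigma:\mathit{Var}\to M_1$ let $h_\sigma:\mathcal V\to M$ be a quantale homomorphism with $h_\sigma(\iota(v))=\sigma(v)$ for all $v$. For a command $C$ let $\Delta^{\mathcal V}_C=\mathcal A^C_{\mathcal V}(1,\iota)$ be the algorithmic typing. Then for every $\sigma:\mathit{Var}\to M_1$ and $W\subseteq\mathit{Var}$, $$h_\sigma\Bigl(\bigotimes_{w\in W}\Delta^{\mathcal V}_C(w)\Bigr)=\alpha^{\mathbb N}_\sigma(\mathbb J^{\mathbb N}_W),\qquad \mathbb J^{\mathbb N}_W=\bigotimes_{w\in W}\Delta^{\mathbb N}_C(w).$$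
   Context: Quantales. A commutative complete quantale $\langle M,\sqsubseteq,\bigvee,\otimes,1\rangle$ is a complete lattice with a commutative monoid $(\otimes,1)$ such that $\otimes$ distributes over arbitrary joins. A quantale homomorphism preserves arbitrary joins, $\otimes$ and $1$. $M_1=\{m\mid 1\sqsubseteq m\}$. $m^0=1$, $m^n$ is the $n$-fold tensor power, $m^*=\bigvee_{n\ge0}m^n$. Empty tensors are $1$. Multiset object. $\mathcal U_{\mathbb N}$ is the set of downsets of $(\mathbb N^{\mathit{Var}},\le)$ ordered by inclusion, with $\bigvee=\bigcup$, $\mathbb M\otimes\mathbb N={\downarrow}\{m+n\mid m\in\mathbb M,n\in\mathbb N\}$, $1={\downarrow}0$; generators $\hat v={\downarrow}e_v$. $\alpha^{\mathbb N}_\sigma(\mathbb M)=\bigvee_{m\in\mathbb M}\bigotimes_v\sigma(v)^{m(v)}$. Language. Commands: $\mathsf{skip}$, $x:=E$, $C_1;C_2$, $\mathsf{if}\;E\;C_1\;C_2$, $\mathsf{while}\;E\;C$; $\mathit{fv}(E)$ is the set of variables of $E$, $\mathit{asgn}(C)$ the set of variables assigned in $C$. Algorithmic system. $t_E(\Gamma)=\bigotimes_{v\in\mathit{fv}(E)}\Gamma(v)$ and $\mathcal A^C_M(p,\Gamma):\mathit{Var}\to M_1$ ($p\in M_1$, $\Gamma:\mathit{Var}\to M_1$) is defined by recursion on $C$: $\Gamma$ for $\mathsf{skip}$; $\Gamma[x\mapsto p\otimes t_E(\Gamma)]$ for $x:=E$; $\mathcal A^{C_2}(p,\mathcal A^{C_1}(p,\Gamma))$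 for $C_1;C_2$; for $\mathsf{if}\;E\;C_1\;C_2$, with $t=t_E(\Gamma)$, $\Gamma_i'=\mathcal A^{C_i}(p\otimes t,\Gamma)$, the environment $x\mapsto t\otimes(\Gamma_1'(x)\vee\Gamma_2'(x))$ for $x\in\mathit{asgn}(C_1)\cup\mathit{asgn}(C_2)$ and $x\mapsto\Gamma(x)$ otherwise; for $\mathsf{while}\;E\;C$, with $\Gamma^*$ the least fixed point of $\Theta\mapsto\Gamma\vee\mathcal A^C(p\otimes t_E(\Theta),\Theta)$ and $t=t_E(\Gamma^* )$, the environment $x\mapsto t^*\otimes\Gamma^*(x)$ for $x\in\mathit{asgn}(C)$ and $x\mapsto\Gamma^*(x)$ otherwise. $\Delta^{\mathbb N}_C=\mathcal A^C_{\mathcal U_{\mathbb N}}(1,v\mapsto\hat v)$. *)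

theory Defs
  imports Main
begin

unbundle lattice_syntax

class comm_quantale = complete_lattice + comm_monoid_mult +
  assumes mult_Sup: "x * \<Squnion>A = (\<Squnion>a\<in>A. x * a)"

definition quantale_hom :: "('a::comm_quantale \<Rightarrow> 'b::comm_quantale) \<Rightarrow> bool" where
  "quantale_hom f \<longleftrightarrow>
     (\<forall>A. f (\<Squnion>A) = (\<Squnion>a\<in>A. f a)) \<and> (\<forall>x y. f (x * y) = f x * f y) \<and> f 1 = 1"

definition qstar :: "'a::comm_quantale \<Rightarrow> 'a" where
  "qstar m = (\<Squnion>n. m ^ n)"

lemma mult_sup_quantale: "x * (a \<squnion> b) = (x * a) \<squnion> (x * (b::'a::comm_quantale))"
  using mult_Sup[of x "{a, b}"] by simp

lemma mult_mono_quantale: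
  fixes a b c d :: "'a::comm_quantale"
  assumes "a \<le> b" "c \<le> d"
  shows "a * c \<le> b * d"
proof -
  have "a * c \<le> a * d"
    using mult_sup_quantale[of a c d] assms(2) by (metis sup.absorb2 sup.cobounded1)
  also have "\<dots> \<le> b * d"
    using mult_sup_quantale[of d a b] assms(1) by (metis mult.commute sup.absorb2 sup.cobounded1)
  finally show ?thesis .
qed

lemma prod_mono_quantale:
  fixes f g :: "'i \<Rightarrow> 'a::comm_quantale"
  assumes "\<And>i. i \<in> I \<Longrightarrow> f i \<le> g i"
  shows "prod f I \<le> prod g I"
  using assms by (induction I rule: infinite_finite_induct) (auto intro: mult_mono_quantale)

lemma power_mono_quantale: "a \<le> b \<Longrightarrow> a ^ n \<le> (b::'a::comm_quantale) ^ n"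
  by (induction n) (auto intro: mult_mono_quantale)

lemma qstar_mono: "a \<le> b \<Longrightarrow> qstar a \<le> qstar b"
  unfolding qstar_def by (intro SUP_mono) (auto intro: power_mono_quantale)

text \<open>
  For a finite type of variables, multisets of variables are all functions into
  \<^typ>\<open>nat\<close>, ordered pointwise.
\<close>

typedef 'v mdown = "{D :: ('v \<Rightarrow> nat) set. \<forall>m\<in>D. \<forall>n\<le>m. n \<in> D}"
  morphisms mset_of Abs_mdown
  by (rule exI[of _ "{}"]) simp

setup_lifting type_definition_mdown

definition down :: "('v \<Rightarrow> nat) set \<Rightarrow> ('v \<Rightarrow> nat) set" where
  "down S = {n. \<exists>m\<in>S. n \<le> m}"

lemma down_closed: "m \<in> down S \<Longrightarrow> n \<le> m \<Longrightarrow> n \<in> down S"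
  unfolding down_def by (blast intro: order_trans)

lemma mem_down_plus:
  "x \<in> down {\<lambda>v. m v + n v | m n. m \<in> D \<and> n \<in> E} \<longleftrightarrow> (\<exists>m\<in>D. \<exists>n\<in>E. \<forall>v. x v \<le> m v + n v)"
proof
  assume "\<exists>m\<in>D. \<exists>n\<in>E. \<forall>v. x v \<le> m v + n v"
  then obtain m n where "m \<in> D" "n \<in> E" "x \<le> (\<lambda>v. m v + n v)"
    unfolding le_fun_def by blast
  moreover from this have "(\<lambda>v. m v + n v) \<in> {\<lambda>v. m v + n v | m n. m \<in> D \<and> n \<in> E}"
    by blast
  ultimately show "x \<in> down {\<lambda>v. m v + n v | m n. m \<in> D \<and> n \<in> E}"
    unfolding down_def by blast
qed (auto simp: down_def le_fun_def)

instantiation mdown :: (type) complete_lattice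
begin
lift_definition less_eq_mdown :: "'a mdown \<Rightarrow> 'a mdown \<Rightarrow> bool" is "(\<subseteq>)" .
lift_definition less_mdown :: "'a mdown \<Rightarrow> 'a mdown \<Rightarrow> bool" is "(\<subset>)" .
lift_definition sup_mdown :: "'a mdown \<Rightarrow> 'a mdown \<Rightarrow> 'a mdown" is "(\<union>)" by blast
lift_definition inf_mdown :: "'a mdown \<Rightarrow> 'a mdown \<Rightarrow> 'a mdown" is "(\<inter>)" by blast
lift_definition bot_mdown :: "'a mdown" is "{}" by blast
lift_definition top_mdown :: "'a mdown" is UNIV by blast
lift_definition Sup_mdown :: "'a mdown set \<Rightarrow> 'a mdown" is "\<lambda>\<D>. \<Union>\<D>" by blast
lift_definition Inf_mdown :: "'a mdown set \<Rightarrow> 'a mdown" is "\<lambda>\<D>. \<Inter>\<D>" by blast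
instance
proof
  fix x y z :: "'a mdown" and A :: "'a mdown set"
  show "x < y \<longleftrightarrow> x \<le> y \<and> \<not> y \<le> x"
    by transfer (rule less_le_not_le)
  show "x \<le> x"
    by transfer (rule subset_refl)
  show "x \<le> y \<Longrightarrow> y \<le> z \<Longrightarrow> x \<le> z"
    by transfer (rule subset_trans)
  show "x \<le> y \<Longrightarrow> y \<le> x \<Longrightarrow> x = y"
    by transfer (rule subset_antisym)
  show "inf x y \<le> x" "inf x y \<le> y"
    by (transfer, rule Int_lower1) (transfer, rule Int_lower2)
  show "x \<le> y \<Longrightarrow> x \<le> z \<Longrightarrow> x \<le> inf y z"
    by transfer (rule Int_greatest)
  show "x \<le> sup x y" "y \<le> sup x y"
    by (transfer, rule Un_upper1) (transfer, rule Un_upper2)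
  show "y \<le> x \<Longrightarrow> z \<le> x \<Longrightarrow> sup y z \<le> x"
    by transfer (rule Un_least)
  show "x \<in> A \<Longrightarrow> Inf A \<le> x"
    by transfer (rule Inter_lower)
  show "(\<And>x. x \<in> A \<Longrightarrow> z \<le> x) \<Longrightarrow> z \<le> Inf A"
    by transfer (rule Inter_greatest, simp)
  show "x \<in> A \<Longrightarrow> x \<le> Sup A"
    by transfer (rule Union_upper)
  show "(\<And>x. x \<in> A \<Longrightarrow> x \<le> z) \<Longrightarrow> Sup A \<le> z"
    by transfer (rule Union_least, simp)
  show "Inf {} = (top :: 'a mdown)"
    by transfer (rule Inter_empty)
  show "Sup {} = (bot :: 'a mdown)"
    by transfer (rule Union_empty)
qed
end

instantiation mdown :: (type) comm_quantale
begin

lift_definition one_mdown :: "'a mdown" is "down {\<lambda>_. 0}"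
  by (rule down_closed)

lift_definition times_mdown :: "'a mdown \<Rightarrow> 'a mdown \<Rightarrow> 'a mdown" is
  "\<lambda>D E. down {\<lambda>v. m v + n v | m n. m \<in> D \<and> n \<in> E}"
  by (rule down_closed)

instance
proof
  fix a b c :: "'a mdown"
  show "a * b = b * a"
  proof transfer
    fix A B :: "('a \<Rightarrow> nat) set"
    have "x \<in> down {\<lambda>v. m v + n v | m n. m \<in> D \<and> n \<in> E} \<longleftrightarrow>
        (\<exists>n\<in>E. \<exists>m\<in>D. \<forall>v. x v \<le> n v + m v)" for x and D E :: "('a \<Rightarrow> nat) set"
      unfolding mem_down_plus by (subst add.commute) blast
    then show "down {\<lambda>v. m v + n v | m n. m \<in> A \<and> n \<in> B} = down {\<lambda>v. m v + n v | m n. m \<in> B \<and> n \<in> A}"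
      by (intro set_eqI) (simp only: mem_down_plus)
  qed
  show "a * b * c = a * (b * c)"
  proof transfer
    fix A B C :: "('a \<Rightarrow> nat) set"
    let ?T = "\<lambda>D E. down {\<lambda>v. m v + n v | m n. m \<in> D \<and> n \<in> E}"
    have "x \<in> ?T (?T A B) C \<longleftrightarrow> (\<exists>m\<in>A. \<exists>n\<in>B. \<exists>k\<in>C. \<forall>v. x v \<le> m v + n v + k v)" for x
    proof
      assume "x \<in> ?T (?T A B) C"
      then obtain l k where l: "l \<in> ?T A B" "k \<in> C" "\<forall>v. x v \<le> l v + k v"
        unfolding mem_down_plus[of x "?T A B"] by blast
      from l(1) obtain m n where mn: "m \<in> A" "n \<in> B" "\<forall>v. l v \<le> m v + n v"
        unfolding mem_down_plus by blast
      have "x v \<le> m v + n v + k v" for v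
        using l(3)[rule_format, of v] mn(3)[rule_format, of v] by linarith
      with l mn show "\<exists>m\<in>A. \<exists>n\<in>B. \<exists>k\<in>C. \<forall>v. x v \<le> m v + n v + k v" by blast
    next
      assume "\<exists>m\<in>A. \<exists>n\<in>B. \<exists>k\<in>C. \<forall>v. x v \<le> m v + n v + k v"
      then obtain m n k where *: "m \<in> A" "n \<in> B" "k \<in> C" "\<forall>v. x v \<le> m v + n v + k v" by blast
      have "(\<lambda>v. m v + n v) \<in> ?T A B" unfolding mem_down_plus using *(1,2) by blast
      then show "x \<in> ?T (?T A B) C" unfolding mem_down_plus[of x "?T A B"]
        using *(3,4) by (intro bexI[of _ "\<lambda>v. m v + n v"] bexI[of _ k])
    qed
    moreover
    have "x \<in> ?T A (?T B C) \<longleftrightarrow> (\<exists>m\<in>A. \<exists>n\<in>B. \<exists>k\<in>C. \<forall>v. x v \<le> m v + n v + k v)" for x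
    proof
      assume "x \<in> ?T A (?T B C)"
      then obtain m l where l: "m \<in> A" "l \<in> ?T B C" "\<forall>v. x v \<le> m v + l v"
        unfolding mem_down_plus[of x A] by blast
      from l(2) obtain n k where mn: "n \<in> B" "k \<in> C" "\<forall>v. l v \<le> n v + k v"
        unfolding mem_down_plus by blast
      have "x v \<le> m v + n v + k v" for v
        using l(3)[rule_format, of v] mn(3)[rule_format, of v] by linarith
      with l mn show "\<exists>m\<in>A. \<exists>n\<in>B. \<exists>k\<in>C. \<forall>v. x v \<le> m v + n v + k v" by blast
    next
      assume "\<exists>m\<in>A. \<exists>n\<in>B. \<exists>k\<in>C. \<forall>v. x v \<le> m v + n v + k v"
      then obtain m n k where *: "m \<in> A" "n \<in> B" "k \<in> C" "\<forall>v. x v \<le> m v + (n v + k v)"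
        unfolding add.assoc by blast
      have "(\<lambda>v. n v + k v) \<in> ?T B C" unfolding mem_down_plus using *(2,3) by blast
      then show "x \<in> ?T A (?T B C)" unfolding mem_down_plus[of x A]
        using *(1,4) by (intro bexI[of _ m] bexI[of _ "\<lambda>v. n v + k v"])
    qed
    ultimately show "?T (?T A B) C = ?T A (?T B C)" by (intro set_eqI) (simp only:)
  qed
  show "1 * a = a"
  proof transfer
    fix D :: "('a \<Rightarrow> nat) set"
    assume D: "\<forall>m\<in>D. \<forall>n\<le>m. n \<in> D"
    have "down {\<lambda>_. 0} = {\<lambda>_::'a. 0::nat}"
      by (auto simp: down_def le_fun_def)
    then have "x \<in> down {\<lambda>v. m v + n v | m n. m \<in> down {\<lambda>_. 0} \<and> n \<in> D} \<longleftrightarrow> (\<exists>n\<in>D. x \<le> n)" for x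
      unfolding mem_down_plus by (simp add: le_fun_def)
    moreover have "(\<exists>n\<in>D. x \<le> n) \<longleftrightarrow> x \<in> D" for x
      using D by blast
    ultimately show "down {\<lambda>v. m v + n v | m n. m \<in> down {\<lambda>_. 0} \<and> n \<in> D} = D"
      by (intro set_eqI) (simp only:)
  qed
  show "a * \<Squnion>X = (\<Squnion>b\<in>X. a * b)" for X
  proof transfer
    fix A :: "('a \<Rightarrow> nat) set" and X :: "('a \<Rightarrow> nat) set set"
    have "(\<exists>m\<in>A. \<exists>n\<in>\<Union>X. P m n) \<longleftrightarrow> (\<exists>D\<in>X. \<exists>m\<in>A. \<exists>n\<in>D. P m n)" for P
      by blast
    then show "down {\<lambda>v. m v + n v | m n. m \<in> A \<and> n \<in> \<Union>X} =
        (\<Union>D\<in>X. down {\<lambda>v. m v + n v | m n. m \<in> A \<and> n \<in> D})"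
      by (intro set_eqI) (simp only: mem_down_plus UN_iff)
  qed
qed

end

lift_definition gen :: "'v \<Rightarrow> 'v mdown" is "\<lambda>v. down {\<lambda>u. if u = v then 1 else 0}"
  by (rule down_closed)

definition alphaN :: "('v::finite \<Rightarrow> 'm::comm_quantale) \<Rightarrow> 'v mdown \<Rightarrow> 'm" where
  "alphaN \<sigma> D = (\<Squnion>m\<in>mset_of D. \<Prod>v\<in>UNIV. \<sigma> v ^ m v)"

text \<open>
  Only the variables of an expression matter, so expressions form an arbitrary type
  \<^typ>\<open>'e\<close>, and the function \<open>fv\<close> giving their variables is a parameter.
\<close>

datatype ('v, 'e) com =
    Skip
  | Assign 'v 'e
  | Seq "('v, 'e) com" "('v, 'e) com"
  | If 'e "('v, 'e) com" "('v, 'e) com"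
  | While 'e "('v, 'e) com"

primrec asgn :: "('v, 'e) com \<Rightarrow> 'v set" where
  "asgn Skip = {}"
| "asgn (Assign x E) = {x}"
| "asgn (Seq C1 C2) = asgn C1 \<union> asgn C2"
| "asgn (If E C1 C2) = asgn C1 \<union> asgn C2"
| "asgn (While E C) = asgn C"

definition texp :: "('e \<Rightarrow> 'v::finite set) \<Rightarrow> 'e \<Rightarrow> ('v \<Rightarrow> 'm::comm_quantale) \<Rightarrow> 'm" where
  "texp fv E \<Gamma> = (\<Prod>v\<in>fv E. \<Gamma> v)"

text \<open>
  Environments range over all of \<^typ>\<open>'v \<Rightarrow> 'm\<close> rather than only those with
  values above \<open>1\<close>. This does not affect the least fixed point in the loop case: every
  (pre-)fixed point lies above \<open>\<Gamma>\<close>, so if \<open>\<Gamma>\<close> is above \<open>1\<close> then so are all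
  of them. See \<open>alg_while_lfp\<close> and \<open>one_le_alg\<close> below.
\<close>

primrec alg ::
  "('e \<Rightarrow> 'v::finite set) \<Rightarrow> ('v, 'e) com \<Rightarrow> 'm::comm_quantale \<Rightarrow> ('v \<Rightarrow> 'm) \<Rightarrow> ('v \<Rightarrow> 'm)" where
  "alg fv Skip p \<Gamma> = \<Gamma>"
| "alg fv (Assign x E) p \<Gamma> = \<Gamma>(x := p * texp fv E \<Gamma>)"
| "alg fv (Seq C1 C2) p \<Gamma> = alg fv C2 p (alg fv C1 p \<Gamma>)"
| "alg fv (If E C1 C2) p \<Gamma> =
     (let t = texp fv E \<Gamma>;
          \<Gamma>1 = alg fv C1 (p * t) \<Gamma>;
          \<Gamma>2 = alg fv C2 (p * t) \<Gamma>
      in (\<lambda>x. if x \<in> asgn C1 \<union> asgn C2 then t * (\<Gamma>1 x \<squnion> \<Gamma>2 x) else \<Gamma> x))"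
| "alg fv (While E C) p \<Gamma> =
     (let \<Gamma>s = lfp (\<lambda>\<Theta>. \<Gamma> \<squnion> alg fv C (p * texp fv E \<Theta>) \<Theta>);
          t = texp fv E \<Gamma>s
      in (\<lambda>x. if x \<in> asgn C then qstar t * \<Gamma>s x else \<Gamma>s x))"

lemma texp_mono: "\<Gamma> \<le> \<Gamma>' \<Longrightarrow> texp fv E \<Gamma> \<le> texp fv E \<Gamma>'"
  unfolding texp_def by (auto intro: prod_mono_quantale simp: le_fun_def)

lemma alg_mono: "p \<le> p' \<Longrightarrow> \<Gamma> \<le> \<Gamma>' \<Longrightarrow> alg fv C p \<Gamma> \<le> alg fv C p' \<Gamma>'"
proof (induction C arbitrary: p p' \<Gamma> \<Gamma>')
  case Skip
  then show ?case by simp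
next
  case (Assign x E)
  then show ?case
    using mult_mono_quantale[OF Assign(1) texp_mono[OF Assign(2)]] by (auto simp: le_fun_def)
next
  case (Seq C1 C2)
  then show ?case by simp
next
  case (If E C1 C2)
  have t: "texp fv E \<Gamma> \<le> texp fv E \<Gamma>'" using If.prems by (intro texp_mono)
  have pt: "p * texp fv E \<Gamma> \<le> p' * texp fv E \<Gamma>'" using If.prems t by (intro mult_mono_quantale)
  have 1: "alg fv C1 (p * texp fv E \<Gamma>) \<Gamma> \<le> alg fv C1 (p' * texp fv E \<Gamma>') \<Gamma>'"
    and 2: "alg fv C2 (p * texp fv E \<Gamma>) \<Gamma> \<le> alg fv C2 (p' * texp fv E \<Gamma>') \<Gamma>'"
    using If pt by blast+
  show ?case
    using t 1 2 If.prems by (auto simp: Let_def le_fun_def intro!: mult_mono_quantale sup_mono)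
next
  case (While E C)
  let ?F = "\<lambda>p \<Gamma> \<Theta>. \<Gamma> \<squnion> alg fv C (p * texp fv E \<Theta>) \<Theta>"
  have l: "lfp (?F p \<Gamma>) \<le> lfp (?F p' \<Gamma>')"
    using While.prems by (intro lfp_mono sup_mono While.IH mult_mono_quantale) auto
  have "qstar (texp fv E (lfp (?F p \<Gamma>))) \<le> qstar (texp fv E (lfp (?F p' \<Gamma>')))"
    using l by (intro qstar_mono texp_mono)
  with l show ?case
    by (auto simp: Let_def le_fun_def intro!: mult_mono_quantale)
qed

lemma alg_while_lfp:
  fixes \<Gamma> :: "'v::finite \<Rightarrow> 'm::comm_quantale" and fv :: "'e \<Rightarrow> 'v set"
    and E :: 'e and C :: "('v, 'e) com" and p :: 'm
  assumes "\<forall>v. 1 \<le> \<Gamma> v"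
  defines "F \<equiv> \<lambda>\<Theta>. \<Gamma> \<squnion> alg fv C (p * texp fv E \<Theta>) \<Theta>"
  shows "\<forall>v. 1 \<le> lfp F v" and "F (lfp F) = lfp F" and "F \<Theta> = \<Theta> \<Longrightarrow> lfp F \<le> \<Theta>"
proof -
  have "mono F"
    unfolding F_def by (intro monoI sup_mono alg_mono mult_mono_quantale texp_mono) auto
  then show fp: "F (lfp F) = lfp F" by (rule lfp_fixpoint)
  have "\<Gamma> \<le> F (lfp F)" unfolding F_def by (rule sup_ge1)
  then have "\<Gamma> v \<le> lfp F v" for v unfolding fp by (rule le_funD)
  then show "\<forall>v. 1 \<le> lfp F v"
    using assms(1) order_trans by blast
  show "F \<Theta> = \<Theta> \<Longrightarrow> lfp F \<le> \<Theta>" by (simp add: lfp_lowerbound)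
qed

lemma one_le_mult_quantale: "1 \<le> a \<Longrightarrow> 1 \<le> b \<Longrightarrow> 1 \<le> a * (b::'a::comm_quantale)"
  using mult_mono_quantale[of 1 a 1 b] by simp

lemma one_le_texp: "\<forall>v. 1 \<le> \<Gamma> v \<Longrightarrow> 1 \<le> texp fv E \<Gamma>"
  unfolding texp_def using prod_mono_quantale[of "fv E" "\<lambda>_. 1" \<Gamma>] by simp

lemma one_le_qstar: "1 \<le> qstar m"
  unfolding qstar_def by (rule order_trans[OF _ SUP_upper[of 0]]) auto

lemma one_le_alg: "1 \<le> p \<Longrightarrow> \<forall>v. 1 \<le> \<Gamma> v \<Longrightarrow> 1 \<le> alg fv C p \<Gamma> x"
proof (induction C arbitrary: p \<Gamma> x)
  case Skip
  then show ?case by simp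
next
  case (Assign y E)
  then show ?case by (simp add: one_le_mult_quantale one_le_texp)
next
  case (Seq C1 C2)
  then show ?case by simp
next
  case (If E C1 C2)
  have t: "1 \<le> texp fv E \<Gamma>" using If.prems by (intro one_le_texp)
  have "1 \<le> alg fv C1 (p * texp fv E \<Gamma>) \<Gamma> x"
    by (rule If.IH(1)[OF one_le_mult_quantale[OF If.prems(1) t] If.prems(2)])
  then have "1 \<le> alg fv C1 (p * texp fv E \<Gamma>) \<Gamma> x \<squnion> alg fv C2 (p * texp fv E \<Gamma>) \<Gamma> x"
    by (rule le_supI1)
  with t If.prems show ?case
    by (simp add: Let_def one_le_mult_quantale)
next
  case (While E C)
  then show ?case
    using alg_while_lfp(1)[OF While.prems(2), where p = p and fv = fv and E = E and C = C]
    by (simp add: Let_def one_le_mult_quantale one_le_qstar)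
qed

unbundle no lattice_syntax

end

theory Submission
  imports Defs
begin

text \<open>
  The algorithm is built from joins, products and least fixed points only, so it commutes with
  every quantale homomorphism. Since \<open>\<sigma>\<close> is above \<open>1\<close>, the map \<open>alphaN \<sigma>\<close>
  is itself a quantale homomorphism sending \<open>gen v\<close> to \<open>\<sigma> v\<close>, so both sides of the
  claim equal the product of the typing computed directly in the target from \<open>\<sigma>\<close>.
\<close>

text \<open>Since \<open>f\<close> preserves all joins, there is a largest element that it maps
  below \<open>lfp G\<close>. By \<open>comm\<close> this element is a pre-fixed point of
  \<open>F\<close>, hence above \<open>lfp F\<close>. Conversely, \<open>f (lfp F)\<close> is a
  fixed point of \<open>G\<close>.\<close>

lemma lfp_fusion:
  fixes f :: "'a::complete_lattice \<Rightarrow> 'b::complete_lattice"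
  assumes Sup: "\<And>A. f (Sup A) = Sup (f ` A)"
    and F: "mono F" and G: "mono G" and comm: "\<And>x. f (F x) = G (f x)"
  shows "f (lfp F) = lfp G"
proof (rule antisym)
  have f_mono: "f x \<le> f y" if "x \<le> y" for x y
    using Sup[of "{x, y}"] that by (simp add: sup_absorb2 le_iff_sup)
  \<comment> \<open>\<open>?s\<close> is the value at \<open>lfp G\<close> of the right adjoint of
    \<open>f\<close>.\<close>
  let ?s = "Sup {x. f x \<le> lfp G}"
  have s: "f ?s \<le> lfp G"
    unfolding Sup by (auto intro: Sup_least)
  have "f (F ?s) \<le> lfp G"
    unfolding comm using monoD[OF G s] lfp_fixpoint[OF G] by simp
  then have "F ?s \<le> ?s"
    by (auto intro: Sup_upper)
  then have "f (lfp F) \<le> f ?s"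
    by (intro f_mono lfp_lowerbound)
  then show "f (lfp F) \<le> lfp G"
    using s by (rule order_trans)
  show "lfp G \<le> f (lfp F)"
    by (rule lfp_lowerbound) (simp add: comm[symmetric] lfp_fixpoint[OF F])
qed

lemma
  assumes "quantale_hom f"
  shows quantale_hom_Sup: "f (Sup A) = Sup (f ` A)"
    and quantale_hom_mult: "f (x * y) = f x * f y"
    and quantale_hom_one: "f 1 = 1"
  using assms by (auto simp: quantale_hom_def)

lemma quantale_hom_sup: "quantale_hom f \<Longrightarrow> f (sup x y) = sup (f x) (f y)"
  using quantale_hom_Sup[of f "{x, y}"] by simp

lemma quantale_hom_prod: "quantale_hom f \<Longrightarrow> f (prod g I) = (\<Prod>i\<in>I. f (g i))"
  by (induction I rule: infinite_finite_induct) (auto simp: quantale_hom_mult quantale_hom_one)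

lemma quantale_hom_power: "quantale_hom f \<Longrightarrow> f (x ^ n) = f x ^ n"
  by (induction n) (auto simp: quantale_hom_mult quantale_hom_one)

lemma quantale_hom_qstar: "quantale_hom f \<Longrightarrow> f (qstar x) = qstar (f x)"
  by (simp add: qstar_def quantale_hom_Sup quantale_hom_power image_image)

lemma quantale_hom_texp: "quantale_hom f \<Longrightarrow> f (texp fv E \<Gamma>) = texp fv E (f \<circ> \<Gamma>)"
  by (simp add: texp_def quantale_hom_prod)

text \<open>The case splits in \<open>alg\<close> depend only on syntax, so they agree on both
  sides. The parameters \<open>p\<close> and \<open>\<Gamma>\<close> must vary in the induction
  because branches and loop bodies change them.\<close>

lemma quantale_hom_alg:
  assumes f: "quantale_hom f"
  shows "f \<circ> alg fv C p \<Gamma> = alg fv C (f p) (f \<circ> \<Gamma>)"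
proof (induction C arbitrary: p \<Gamma>)
  case Skip
  then show ?case by simp
next
  case (Assign x E)
  then show ?case
    by (simp add: fun_eq_iff comp_def quantale_hom_mult[OF f] quantale_hom_texp[OF f])
next
  case (Seq C1 C2)
  then show ?case by simp
next
  case (If E C1 C2)
  have "f (alg fv C1 q \<Gamma> x) = alg fv C1 (f q) (f \<circ> \<Gamma>) x"
    "f (alg fv C2 q \<Gamma> x) = alg fv C2 (f q) (f \<circ> \<Gamma>) x" for q x
    by (metis If.IH(1) comp_apply, metis If.IH(2) comp_apply)
  then show ?case
    by (simp add: Let_def fun_eq_iff comp_def quantale_hom_mult[OF f] quantale_hom_sup[OF f]
        quantale_hom_texp[OF f])
next
  case (While E C)
  let ?F = "\<lambda>\<Theta>. sup \<Gamma> (alg fv C (p * texp fv E \<Theta>) \<Theta>)"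
  let ?G = "\<lambda>\<Theta>. sup (f \<circ> \<Gamma>) (alg fv C (f p * texp fv E \<Theta>) \<Theta>)"
  have lfp: "f \<circ> lfp ?F = lfp ?G"
  \<comment> \<open>Environments form a complete lattice with pointwise joins, so post-composition
    with \<open>f\<close> preserves all joins and fusion applies to it.\<close>
  proof (rule lfp_fusion[where f = "(\<circ>) f"])
    show "f \<circ> Sup A = Sup ((\<circ>) f ` A)" for A :: "('v \<Rightarrow> 'a) set"
      by (simp add: fun_eq_iff quantale_hom_Sup[OF f] image_image)
    show "mono ?F" "mono ?G"
      by (intro monoI sup_mono alg_mono mult_mono_quantale texp_mono order_refl; assumption)+
    show "f \<circ> ?F \<Theta> = ?G (f \<circ> \<Theta>)" for \<Theta>
    proof -
      have "f \<circ> ?F \<Theta> = sup (f \<circ> \<Gamma>) (f \<circ> alg fv C (p * texp fv E \<Theta>) \<Theta>)"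
        by (simp add: fun_eq_iff quantale_hom_sup[OF f])
      then show ?thesis
        by (simp only: While.IH quantale_hom_mult[OF f] quantale_hom_texp[OF f])
    qed
  qed
  then have lfp_app: "f (lfp ?F x) = lfp ?G x" for x
    by (metis comp_apply)
  show ?case
    by (simp add: Let_def fun_eq_iff quantale_hom_mult[OF f] quantale_hom_qstar[OF f]
        quantale_hom_texp[OF f] lfp lfp_app) (simp add: comp_def)
qed

lemma power_increasing_quantale:
  assumes "1 \<le> (a::'a::comm_quantale)" "m \<le> n"
  shows "a ^ m \<le> a ^ n"
proof -
  have "a ^ m * 1 \<le> a ^ m * a ^ (n - m)"
    using power_mono_quantale[OF assms(1), of "n - m"] by (intro mult_mono_quantale) auto
  then show ?thesis
    using assms(2) by (simp flip: power_add)
qed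

text \<open>Every element of \<open>down S\<close> is dominated by one of \<open>S\<close>. The
  product, unit and generators of \<open>mdown\<close> are all given as such closures; this removes
  them under a join.\<close>

lemma SUP_down:
  assumes mono: "\<And>m n. m \<le> n \<Longrightarrow> \<phi> m \<le> (\<phi> n :: 'a::complete_lattice)"
  shows "(SUP m\<in>down S. \<phi> m) = (SUP m\<in>S. \<phi> m)"
proof (rule SUP_eq)
  show "\<exists>n\<in>S. \<phi> m \<le> \<phi> n" if "m \<in> down S" for m
    using that mono unfolding down_def by blast
  show "\<exists>n\<in>down S. \<phi> m \<le> \<phi> n" if "m \<in> S" for m
    using that unfolding down_def by blast
qed

lemma SUP_mult_SUP_quantale:
  "(SUP i\<in>I. f i) * (SUP j\<in>J. g j) = (SUP (i, j)\<in>I \<times> J. f i * (g j :: 'a::comm_quantale))"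
proof -
  \<comment> \<open>\<open>mult_Sup\<close> distributes over a join in the right factor only;
    commutativity brings the other join there.\<close>
  have "(SUP i\<in>I. f i) * (SUP j\<in>J. g j) = (SUP j\<in>J. SUP i\<in>I. g j * f i)"
    by (simp add: mult_Sup image_image mult.commute[of "Sup (f ` I)"])
  also have "\<dots> = (SUP (i, j)\<in>I \<times> J. f i * g j)"
    by (rule antisym)
      (auto intro!: SUP_least intro: SUP_upper2[of "(_, _)"] SUP_upper2 simp: mult.commute)
  finally show ?thesis .
qed

lemma
  fixes \<sigma> :: "'v::finite \<Rightarrow> 'm::comm_quantale"
  assumes \<sigma>: "\<And>v. 1 \<le> \<sigma> v"
  shows quantale_hom_alphaN: "quantale_hom (alphaN \<sigma>)"
    and alphaN_gen: "alphaN \<sigma> (gen v) = \<sigma> v"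
proof -
  let ?\<phi> = "\<lambda>m. \<Prod>v\<in>UNIV. \<sigma> v ^ m v"
  \<comment> \<open>Here \<open>1 \<le> \<sigma> v\<close> enters: raising an exponent can only
    enlarge a monomial.\<close>
  have mono: "?\<phi> m \<le> ?\<phi> n" if "m \<le> n" for m n
    using that \<sigma> by (intro prod_mono_quantale power_increasing_quantale) (auto simp: le_fun_def)
  have down: "(SUP m\<in>down S. ?\<phi> m) = (SUP m\<in>S. ?\<phi> m)" for S
    by (rule SUP_down) (rule mono)
  have "alphaN \<sigma> (Sup A) = Sup (alphaN \<sigma> ` A)" for A
    by (simp add: alphaN_def Sup_mdown.rep_eq SUP_UNION)
  moreover have "alphaN \<sigma> (D * E) = alphaN \<sigma> D * alphaN \<sigma> E" for D E
  proof -
    \<comment> \<open>As an image of a product set, the index set matches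
      \<open>SUP_mult_SUP_quantale\<close>; then the monomial of a sum of multisets splits into the
      product of their monomials.\<close>
    have S: "{\<lambda>v. m v + n v | m n. m \<in> mset_of D \<and> n \<in> mset_of E}
        = (\<lambda>(m, n) v. m v + n v) ` (mset_of D \<times> mset_of E)"
      by auto
    show ?thesis
      unfolding alphaN_def times_mdown.rep_eq down SUP_mult_SUP_quantale S image_image
      by (simp add: case_prod_beta power_add prod.distrib)
  qed
  moreover have "alphaN \<sigma> 1 = 1"
    by (simp add: alphaN_def one_mdown.rep_eq down)
  ultimately show "quantale_hom (alphaN \<sigma>)"
    by (simp add: quantale_hom_def)
  have "?\<phi> (\<lambda>u. if u = v then 1 else 0) = (\<Prod>u\<in>UNIV. if u = v then \<sigma> u else 1)"
    by (intro prod.cong) auto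
  then show "alphaN \<sigma> (gen v) = \<sigma> v"
    by (simp add: alphaN_def gen.rep_eq down)
qed

theorem proposition8:
  fixes fv :: "'e \<Rightarrow> 'v::finite set"
    and \<iota> :: "'v \<Rightarrow> 'q::comm_quantale"
    and h :: "('v \<Rightarrow> 'm::comm_quantale) \<Rightarrow> 'q \<Rightarrow> 'm"
    and C :: "('v, 'e) com"
    and \<sigma> :: "'v \<Rightarrow> 'm"
    and W :: "'v set"
  assumes "\<And>v. 1 \<le> \<iota> v"
    and "\<And>\<tau>. \<forall>v. 1 \<le> \<tau> v \<Longrightarrow> quantale_hom (h \<tau>) \<and> (\<forall>v. h \<tau> (\<iota> v) = \<tau> v)"
    and "\<And>v. 1 \<le> \<sigma> v"
  shows "h \<sigma> (\<Prod>w\<in>W. alg fv C 1 \<iota> w) = alphaN \<sigma> (\<Prod>w\<in>W. alg fv C 1 gen w)"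
proof -
  have h: "quantale_hom (h \<sigma>)" "h \<sigma> \<circ> \<iota> = \<sigma>"
    using assms(2,3) by (auto simp: fun_eq_iff)
  have a: "quantale_hom (alphaN \<sigma>)" "alphaN \<sigma> \<circ> gen = \<sigma>"
    using quantale_hom_alphaN[of \<sigma>] alphaN_gen[of \<sigma>] assms(3) by (auto simp: fun_eq_iff)
  \<comment> \<open>The initial \<open>p = 1\<close> is fixed by every homomorphism, so only the
    environment changes.\<close>
  have "h \<sigma> (alg fv C 1 \<iota> w) = alg fv C 1 \<sigma> w" for w
    by (metis quantale_hom_alg[OF h(1)] quantale_hom_one[OF h(1)] h(2) comp_apply)
  moreover have "alphaN \<sigma> (alg fv C 1 gen w) = alg fv C 1 \<sigma> w" for w
    by (metis quantale_hom_alg[OF a(1)] quantale_hom_one[OF a(1)] a(2) comp_apply)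
  ultimately show ?thesis
    by (simp add: quantale_hom_prod h(1) a(1))
qed

end
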